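(* Fully residually post-injunctive groups are post-injunctive. That is, let $G$ be a group such that for every finite subset $E\subset G$ there exist a post-injunctive group $K$ and a surjective group homomorphism $\varphi\colon G\to K$ whose restriction $\varphi|_E$ is injective. Then $G$ is post-injunctive.
   Context: For a group $G$ and a set $A$ (the alphabet), $A^G$ is the set of all maps $x\colon G\to A$ (configurations), with shift action $(gx)(h)=x(g^{-1}h)$. A cellular automaton $\tau\colon A^G\to A^G$ is a map for which there exist a finite subset $M\subset G$ (a memory set) and a map $\mu\colon A^M\to A$ (the local transition map) such that $\tau(x)(g)=\mu((g^{-1}x)|_M)$ for all $x\in A^G$, $g\in G$. Two configurations $x,y\in A^G$ are asymptotic if $x|_{G\setminus E}=y|_{G\setminus E}$ for some finite $E\subset G$. The cellular automaton $\tau$ is pre-injective if for all asymptotic $x,y\in A^G$, $\tau(x)=\tau(y)$ implies $x=y$. It is post-surjective if for all $x,y\in A^G$ with $y$ asymptotic to $\tau(x)$, there exists $z\in A^G$ asymptotic to $x$ with $\tau(z)=y$. A group $G$ is post-injunctive if for every finite alphabet $A$, every post-surjective cellular automaton $\tau\colon A^G\to A^G$ is pre-injective. *)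

theory Defs
  imports "HOL-Algebra.Group"
begin

text \<open>
  The set of configurations is the extensional function space
  \<open>carrier G \<rightarrow>\<^sub>E A\<close>, so that HOL equality of
  configurations is equality of maps on the carrier. A self-map of it is a HOL function of which
  only the values on configurations matter.
\<close>

definition configs :: "('g, 'm) monoid_scheme \<Rightarrow> 'a set \<Rightarrow> ('g \<Rightarrow> 'a) set" where
  "configs G A = carrier G \<rightarrow>\<^sub>E A"

definition shift :: "('g, 'm) monoid_scheme \<Rightarrow> 'g \<Rightarrow> ('g \<Rightarrow> 'a) \<Rightarrow> ('g \<Rightarrow> 'a)" where
  "shift G g x = (\<lambda>h\<in>carrier G. x (inv\<^bsub>G\<^esub> g \<otimes>\<^bsub>G\<^esub> h))"

definition cellular_automaton ::
    "('g, 'm) monoid_scheme \<Rightarrow> 'a set \<Rightarrow> (('g \<Rightarrow> 'a) \<Rightarrow> ('g \<Rightarrow> 'a)) \<Rightarrow> bool" where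
  "cellular_automaton G A \<tau> \<longleftrightarrow>
     \<tau> \<in> configs G A \<rightarrow> configs G A \<and>
     (\<exists>M \<mu>. finite M \<and> M \<subseteq> carrier G \<and> \<mu> \<in> (M \<rightarrow>\<^sub>E A) \<rightarrow> A \<and>
        (\<forall>x\<in>configs G A. \<forall>g\<in>carrier G. \<tau> x g = \<mu> (restrict (shift G (inv\<^bsub>G\<^esub> g) x) M)))"

definition asymptotic :: "('g, 'm) monoid_scheme \<Rightarrow> ('g \<Rightarrow> 'a) \<Rightarrow> ('g \<Rightarrow> 'a) \<Rightarrow> bool" where
  "asymptotic G x y \<longleftrightarrow>
     (\<exists>E. finite E \<and> E \<subseteq> carrier G \<and> restrict x (carrier G - E) = restrict y (carrier G - E))"

definition pre_injective ::
    "('g, 'm) monoid_scheme \<Rightarrow> 'a set \<Rightarrow> (('g \<Rightarrow> 'a) \<Rightarrow> ('g \<Rightarrow> 'a)) \<Rightarrow> bool" where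
  "pre_injective G A \<tau> \<longleftrightarrow>
     (\<forall>x\<in>configs G A. \<forall>y\<in>configs G A. asymptotic G x y \<longrightarrow> \<tau> x = \<tau> y \<longrightarrow> x = y)"

definition post_surjective ::
    "('g, 'm) monoid_scheme \<Rightarrow> 'a set \<Rightarrow> (('g \<Rightarrow> 'a) \<Rightarrow> ('g \<Rightarrow> 'a)) \<Rightarrow> bool" where
  "post_surjective G A \<tau> \<longleftrightarrow>
     (\<forall>x\<in>configs G A. \<forall>y\<in>configs G A. asymptotic G y (\<tau> x) \<longrightarrow>
        (\<exists>z\<in>configs G A. asymptotic G z x \<and> \<tau> z = y))"

text \<open>
  HOL cannot quantify over all types inside a definition, so the finite alphabets range over the
  finite sets of natural numbers. Every finite set is in bijection with one of these, and
  \<open>post_injunctiveD\<close> below recovers the property for finite alphabets in arbitrary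
  types.
\<close>

definition post_injunctive :: "('g, 'm) monoid_scheme \<Rightarrow> bool" where
  "post_injunctive G \<longleftrightarrow>
     (\<forall>(A :: nat set) \<tau>. finite A \<longrightarrow> cellular_automaton G A \<tau> \<longrightarrow>
        post_surjective G A \<tau> \<longrightarrow> pre_injective G A \<tau>)"

definition recode :: "('g, 'm) monoid_scheme \<Rightarrow> ('a \<Rightarrow> 'b) \<Rightarrow> ('g \<Rightarrow> 'a) \<Rightarrow> ('g \<Rightarrow> 'b)" where
  "recode G f x = (\<lambda>h\<in>carrier G. f (x h))"

lemma recode_configs: "f \<in> A \<rightarrow> B \<Longrightarrow> x \<in> configs G A \<Longrightarrow> recode G f x \<in> configs G B"
  unfolding recode_def configs_def by auto

lemma recode_inverse:
  assumes "\<And>a. a \<in> A \<Longrightarrow> f' (f a) = a" and "x \<in> configs G A"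
  shows "recode G f' (recode G f x) = x"
  using assms unfolding recode_def configs_def
  by (auto simp: fun_eq_iff restrict_def PiE_iff extensional_def)

lemma recode_asymptotic:
  assumes "asymptotic G x y"
  shows "asymptotic G (recode G f x) (recode G f y)"
proof -
  obtain E where E: "finite E" "E \<subseteq> carrier G"
    "restrict x (carrier G - E) = restrict y (carrier G - E)"
    using assms unfolding asymptotic_def by blast
  have "x h = y h" if "h \<in> carrier G - E" for h
    using fun_cong[OF E(3), of h] that by simp
  then have "restrict (recode G f x) (carrier G - E) = restrict (recode G f y) (carrier G - E)"
    by (auto simp: recode_def restrict_def fun_eq_iff)
  with E show ?thesis unfolding asymptotic_def by blast
qed

lemma post_injunctiveD:
  fixes A :: "'a set"
  assumes "group G" and "post_injunctive G" and "finite A"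
    and "cellular_automaton G A \<tau>" and "post_surjective G A \<tau>"
  shows "pre_injective G A \<tau>"
proof -
  interpret group G by fact
  obtain f :: "'a \<Rightarrow> nat" and n where f: "bij_betw f A {..<n}"
    using \<open>finite A\<close> by (metis atLeast0LessThan ex_bij_betw_finite_nat)
  define B where "B = {..<n}"
  define f' where "f' = inv_into A f"
  have fB: "f \<in> A \<rightarrow> B" and fA: "f' \<in> B \<rightarrow> A"
    using f bij_betw_inv_into[OF f] unfolding B_def f'_def bij_betw_def by auto
  have ff: "f' (f a) = a" if "a \<in> A" for a
    using f that unfolding f'_def by (simp add: bij_betw_inv_into_left)
  have ff': "f (f' b) = b" if "b \<in> B" for b
    using f that unfolding f'_def B_def by (simp add: bij_betw_inv_into_right)
  note FB = recode_configs[OF fB, where G = G] and FA = recode_configs[OF fA, where G = G]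
  note FF = recode_inverse[where f = f and f' = f', OF ff]
    and FF' = recode_inverse[where f = f' and f' = f, OF ff']
  define \<sigma> where "\<sigma> y = recode G f (\<tau> (recode G f' y))" for y
  obtain M \<mu> where \<tau>: "\<And>x. x \<in> configs G A \<Longrightarrow> \<tau> x \<in> configs G A"
    and M: "finite M" "M \<subseteq> carrier G" and \<mu>: "\<mu> \<in> (M \<rightarrow>\<^sub>E A) \<rightarrow> A"
    and \<tau>\<mu>: "\<And>x g. x \<in> configs G A \<Longrightarrow> g \<in> carrier G \<Longrightarrow>
          \<tau> x g = \<mu> (restrict (shift G (inv\<^bsub>G\<^esub> g) x) M)"
    using \<open>cellular_automaton G A \<tau>\<close> unfolding cellular_automaton_def by blast
  define \<nu> where "\<nu> p = f (\<mu> (\<lambda>m\<in>M. f' (p m)))" for p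
  have "\<sigma> y g = \<nu> (restrict (shift G (inv\<^bsub>G\<^esub> g) y) M)"
    if "y \<in> configs G B" "g \<in> carrier G" for y g
  proof -
    have "restrict (shift G (inv\<^bsub>G\<^esub> g) (recode G f' y)) M
        = (\<lambda>m\<in>M. f' (restrict (shift G (inv\<^bsub>G\<^esub> g) y) M m))"
      using M(2) that by (auto simp: restrict_def fun_eq_iff shift_def recode_def)
    then show ?thesis
      using \<tau>\<mu>[OF FA[OF that(1)] that(2)] that(2) unfolding \<sigma>_def \<nu>_def
      by (simp add: recode_def)
  qed
  moreover have "\<nu> \<in> (M \<rightarrow>\<^sub>E B) \<rightarrow> B"
  proof
    fix p assume "p \<in> M \<rightarrow>\<^sub>E B"
    then have "(\<lambda>m\<in>M. f' (p m)) \<in> M \<rightarrow>\<^sub>E A" using fA by auto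
    then show "\<nu> p \<in> B" using \<mu> fB unfolding \<nu>_def by blast
  qed
  moreover have "\<sigma> \<in> configs G B \<rightarrow> configs G B"
    unfolding \<sigma>_def using FA \<tau> FB by blast
  ultimately have ca: "cellular_automaton G B \<sigma>"
    using M unfolding cellular_automaton_def by blast
  have ps: "post_surjective G B \<sigma>"
    unfolding post_surjective_def
  proof (intro ballI impI)
    fix x y assume x: "x \<in> configs G B" and y: "y \<in> configs G B" and a: "asymptotic G y (\<sigma> x)"
    have "asymptotic G (recode G f' y) (\<tau> (recode G f' x))"
      using recode_asymptotic[OF a, of f'] FF[OF _ \<tau>[OF FA[OF x]]] unfolding \<sigma>_def by simp
    then obtain z where z: "z \<in> configs G A" "asymptotic G z (recode G f' x)"
        "\<tau> z = recode G f' y"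
      using \<open>post_surjective G A \<tau>\<close> FA[OF x] FA[OF y] unfolding post_surjective_def by blast
    have "asymptotic G (recode G f z) x"
      using recode_asymptotic[OF z(2), of f] FF'[OF _ x] by simp
    moreover have "\<sigma> (recode G f z) = y"
      unfolding \<sigma>_def using FF[OF _ z(1)] z(3) FF'[OF _ y] by simp
    ultimately show "\<exists>z\<in>configs G B. asymptotic G z x \<and> \<sigma> z = y" using FB[OF z(1)] by blast
  qed
  have pin: "pre_injective G B \<sigma>"
    using \<open>post_injunctive G\<close> ca ps unfolding post_injunctive_def B_def by blast
  show ?thesis
    unfolding pre_injective_def
  proof (intro ballI impI)
    fix x y assume x: "x \<in> configs G A" and y: "y \<in> configs G A"
      and a: "asymptotic G x y" and e: "\<tau> x = \<tau> y"
    have "\<sigma> (recode G f x) = \<sigma> (recode G f y)"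
      unfolding \<sigma>_def using FF[OF _ x] FF[OF _ y] e by simp
    then have "recode G f x = recode G f y"
      using pin FB[OF x] FB[OF y] recode_asymptotic[OF a] unfolding pre_injective_def by blast
    then show "x = y" using FF[OF _ x] FF[OF _ y] by metis
  qed
qed

end

theory Submission
  imports Defs "HOL-Analysis.Product_Topology"
begin

text \<open>
  Compactness of the configuration space makes post-surjectivity uniform: there is a finite set
  \<open>E\<close> such that changing the value of \<open>\<tau> x\<close> at the identity can always be realised by
  changing \<open>x\<close> inside \<open>E\<close> only. An epimorphism \<open>\<phi>\<close> onto \<open>K\<close> that is
  injective on a large enough finite window around \<open>E\<close> carries these local corrections over, so
  the automaton on \<open>K\<close> with the same local rule is post-surjective as well, hence pre-injective.
  If \<open>\<phi>\<close> is also injective on a window around the set where two asymptotic configurations of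
  \<open>G\<close> with the same image differ, these can be copied to \<open>K\<close>, where they must coincide.
\<close>

section \<open>Local rules\<close>

text \<open>The pattern \<open>m \<mapsto> x (g \<otimes> m)\<close> is the restriction to
  \<open>M\<close> of the shift of \<open>x\<close> by the inverse of \<open>g\<close>. Written this
  way, the cells read at \<open>g\<close> are visible as the right translates of \<open>g\<close> by
  \<open>M\<close>, and the result is extensional.\<close>

definition local_map ::
    "('g, 'm) monoid_scheme \<Rightarrow> 'g set \<Rightarrow> (('g \<Rightarrow> 'a) \<Rightarrow> 'a) \<Rightarrow> ('g \<Rightarrow> 'a) \<Rightarrow> ('g \<Rightarrow> 'a)" where
  "local_map G M \<mu> x = (\<lambda>g\<in>carrier G. \<mu> (\<lambda>m\<in>M. x (g \<otimes>\<^bsub>G\<^esub> m)))"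

lemma local_map_cong:
  assumes "g \<in> carrier G" and "\<And>m. m \<in> M \<Longrightarrow> x (g \<otimes>\<^bsub>G\<^esub> m) = y (g \<otimes>\<^bsub>G\<^esub> m)"
  shows "local_map G M \<mu> x g = local_map G M \<mu> y g"
proof -
  have "(\<lambda>m\<in>M. x (g \<otimes>\<^bsub>G\<^esub> m)) = (\<lambda>m\<in>M. y (g \<otimes>\<^bsub>G\<^esub> m))"
    using assms(2) by (rule restrict_ext)
  then show ?thesis using assms(1) by (simp add: local_map_def)
qed

lemma configsD: "x \<in> configs G A \<Longrightarrow> g \<in> carrier G \<Longrightarrow> x g \<in> A"
  unfolding configs_def by auto

lemma configs_restrictI: "(\<And>g. g \<in> carrier G \<Longrightarrow> f g \<in> A) \<Longrightarrow> (\<lambda>g\<in>carrier G. f g) \<in> configs G A"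
  unfolding configs_def by auto

lemma configs_eqI:
  "x \<in> configs G A \<Longrightarrow> y \<in> configs G A \<Longrightarrow> (\<And>g. g \<in> carrier G \<Longrightarrow> x g = y g) \<Longrightarrow> x = y"
  unfolding configs_def by (rule PiE_ext)

lemma configs_upd:
  "x \<in> configs G A \<Longrightarrow> g \<in> carrier G \<Longrightarrow> a \<in> A \<Longrightarrow> x(g := a) \<in> configs G A"
  unfolding configs_def by (auto simp: PiE_iff extensional_def)

lemma local_map_configs:
  assumes "group G" "M \<subseteq> carrier G" "\<mu> \<in> (M \<rightarrow>\<^sub>E A) \<rightarrow> A" "x \<in> configs G A"
  shows "local_map G M \<mu> x \<in> configs G A"
proof -
  interpret group G by fact
  have "(\<lambda>m\<in>M. x (g \<otimes>\<^bsub>G\<^esub> m)) \<in> M \<rightarrow>\<^sub>E A" if "g \<in> carrier G" for g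
    using assms(2) configsD[OF assms(4)] that by auto
  then show ?thesis
    using assms(3) unfolding local_map_def by (intro configs_restrictI) blast
qed

lemma restrict_shift:
  assumes "group G" "M \<subseteq> carrier G" "g \<in> carrier G"
  shows "restrict (shift G (inv\<^bsub>G\<^esub> g) x) M = (\<lambda>m\<in>M. x (g \<otimes>\<^bsub>G\<^esub> m))"
proof -
  interpret group G by fact
  show ?thesis using assms(2,3) by (auto simp: shift_def fun_eq_iff restrict_def)
qed

text \<open>Both sides of the pointwise condition are extensional, so it becomes an equality of
  functions. The equality is confined to configurations, where alone \<tau> is specified.\<close>

lemma cellular_automaton_iff:
  assumes "group G"
  shows "cellular_automaton G A \<tau> \<longleftrightarrow>
    (\<exists>M \<mu>. finite M \<and> M \<subseteq> carrier G \<and> \<mu> \<in> (M \<rightarrow>\<^sub>E A) \<rightarrow> A \<and>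
       (\<forall>x\<in>configs G A. \<tau> x = local_map G M \<mu> x))"
proof
  assume "cellular_automaton G A \<tau>"
  then obtain M \<mu> where \<tau>: "\<And>x. x \<in> configs G A \<Longrightarrow> \<tau> x \<in> configs G A"
    and M: "finite M" "M \<subseteq> carrier G" and \<mu>: "\<mu> \<in> (M \<rightarrow>\<^sub>E A) \<rightarrow> A"
    and eq: "\<And>x g. x \<in> configs G A \<Longrightarrow> g \<in> carrier G \<Longrightarrow>
          \<tau> x g = \<mu> (restrict (shift G (inv\<^bsub>G\<^esub> g) x) M)"
    unfolding cellular_automaton_def by blast
  have "\<tau> x = local_map G M \<mu> x" if "x \<in> configs G A" for x
    using \<tau>[OF that] local_map_configs[OF assms M(2) \<mu> that]
    by (rule configs_eqI) (simp add: eq[OF that] restrict_shift[OF assms M(2)] local_map_def)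
  with M \<mu> show "\<exists>M \<mu>. finite M \<and> M \<subseteq> carrier G \<and> \<mu> \<in> (M \<rightarrow>\<^sub>E A) \<rightarrow> A \<and>
       (\<forall>x\<in>configs G A. \<tau> x = local_map G M \<mu> x)" by blast
next
  assume "\<exists>M \<mu>. finite M \<and> M \<subseteq> carrier G \<and> \<mu> \<in> (M \<rightarrow>\<^sub>E A) \<rightarrow> A \<and>
       (\<forall>x\<in>configs G A. \<tau> x = local_map G M \<mu> x)"
  then obtain M \<mu> where M: "finite M" "M \<subseteq> carrier G" and \<mu>: "\<mu> \<in> (M \<rightarrow>\<^sub>E A) \<rightarrow> A"
    and eq: "\<And>x. x \<in> configs G A \<Longrightarrow> \<tau> x = local_map G M \<mu> x" by blast
  have "\<tau> x g = \<mu> (restrict (shift G (inv\<^bsub>G\<^esub> g) x) M)"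
    if "x \<in> configs G A" "g \<in> carrier G" for x g
    using that by (simp add: eq restrict_shift[OF assms M(2)] local_map_def)
  moreover have "\<tau> \<in> configs G A \<rightarrow> configs G A"
    using eq local_map_configs[OF assms M(2) \<mu>] by auto
  ultimately show "cellular_automaton G A \<tau>"
    using M \<mu> unfolding cellular_automaton_def by blast
qed

section \<open>Asymptotic configurations and the shift action\<close>

lemma asymptotic_iff:
  "asymptotic G x y \<longleftrightarrow> (\<exists>E. finite E \<and> E \<subseteq> carrier G \<and> (\<forall>h\<in>carrier G - E. x h = y h))"
proof -
  have "restrict x S = restrict y S \<longleftrightarrow> (\<forall>h\<in>S. x h = y h)" for S
    by (metis restrict_apply restrict_ext)
  then show ?thesis unfolding asymptotic_def by simp
qed

lemma asymptotic_refl: "asymptotic G x x"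
  unfolding asymptotic_def by blast

lemma asymptotic_trans:
  assumes "asymptotic G x y" "asymptotic G y z"
  shows "asymptotic G x z"
proof -
  obtain E F where "finite E" "E \<subseteq> carrier G" "\<forall>h\<in>carrier G - E. x h = y h"
    "finite F" "F \<subseteq> carrier G" "\<forall>h\<in>carrier G - F. y h = z h"
    using assms unfolding asymptotic_iff by blast
  then show ?thesis
    unfolding asymptotic_iff by (intro exI[of _ "E \<union> F"]) auto
qed

lemma asymptotic_shift:
  assumes "group G" "g \<in> carrier G" "asymptotic G x y"
  shows "asymptotic G (shift G g x) (shift G g y)"
proof -
  interpret group G by fact
  obtain E where E: "finite E" "E \<subseteq> carrier G" "\<And>h. h \<in> carrier G - E \<Longrightarrow> x h = y h"
    using assms(3) unfolding asymptotic_iff by blast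
  have "shift G g x h = shift G g y h"
    if "h \<in> carrier G - (\<lambda>e. g \<otimes>\<^bsub>G\<^esub> e) ` E" for h
  proof -
    have "h = g \<otimes>\<^bsub>G\<^esub> (inv\<^bsub>G\<^esub> g \<otimes>\<^bsub>G\<^esub> h)"
      using that assms(2) by (simp add: m_assoc[symmetric])
    then have "inv\<^bsub>G\<^esub> g \<otimes>\<^bsub>G\<^esub> h \<in> carrier G - E"
      using that assms(2) by auto
    then show ?thesis using that E(3) by (simp add: shift_def)
  qed
  with E show ?thesis
    using assms(2) unfolding asymptotic_iff
    by (intro exI[of _ "(\<lambda>e. g \<otimes>\<^bsub>G\<^esub> e) ` E"]) auto
qed

lemma shift_configs:
  assumes "group G" "g \<in> carrier G" "x \<in> configs G A"
  shows "shift G g x \<in> configs G A"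
proof -
  interpret group G by fact
  show ?thesis
    unfolding shift_def using configsD[OF assms(3)] assms(2) by (intro configs_restrictI) auto
qed

lemma shift_shift_inv:
  assumes "group G" "g \<in> carrier G" "x \<in> configs G A"
  shows "shift G g (shift G (inv\<^bsub>G\<^esub> g) x) = x"
proof -
  interpret group G by fact
  show ?thesis
    using assms(2)
    by (intro configs_eqI[OF shift_configs[OF assms(1,2) shift_configs[OF assms(1) _ assms(3)]] assms(3)])
      (auto simp: shift_def m_assoc[symmetric])
qed

text \<open>Shifts multiply a cell on the left while the rule reads its right translates by
  \<open>M\<close>, so associativity makes the two commute.\<close>

lemma local_map_shift:
  assumes "group G" "M \<subseteq> carrier G" "g \<in> carrier G"
  shows "local_map G M \<mu> (shift G g x) = shift G g (local_map G M \<mu> x)"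
proof -
  interpret group G by fact
  have "local_map G M \<mu> (shift G g x) h = local_map G M \<mu> x (inv\<^bsub>G\<^esub> g \<otimes>\<^bsub>G\<^esub> h)"
    if "h \<in> carrier G" for h
  proof -
    have "(\<lambda>m\<in>M. shift G g x (h \<otimes>\<^bsub>G\<^esub> m)) = (\<lambda>m\<in>M. x (inv\<^bsub>G\<^esub> g \<otimes>\<^bsub>G\<^esub> h \<otimes>\<^bsub>G\<^esub> m))"
      using assms(2,3) that by (intro restrict_ext) (auto simp: shift_def m_assoc)
    then show ?thesis using that assms(3) by (simp add: local_map_def)
  qed
  then show ?thesis by (auto simp: shift_def local_map_def fun_eq_iff)
qed

text \<open>Equivariance carries a correction at the identity to any other cell, and a finite
  difference is removed by correcting one cell after another.\<close>

lemma post_surjective_local_mapI: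
  assumes "group G" "M \<subseteq> carrier G" "\<mu> \<in> (M \<rightarrow>\<^sub>E A) \<rightarrow> A"
    and one: "\<And>x a. x \<in> configs G A \<Longrightarrow> a \<in> A \<Longrightarrow>
      \<exists>z\<in>configs G A. asymptotic G z x \<and> local_map G M \<mu> z = (local_map G M \<mu> x)(\<one>\<^bsub>G\<^esub> := a)"
  shows "post_surjective G A (local_map G M \<mu>)"
proof -
  interpret group G by fact
  let ?\<tau> = "local_map G M \<mu>"
  \<comment> \<open>Shift by the inverse of \<open>g\<close> to bring the cell \<open>g\<close> to
    the identity, correct the value there, and shift back.\<close>
  have pt: "\<exists>z\<in>configs G A. asymptotic G z x \<and> ?\<tau> z = (?\<tau> x)(g := a)"
    if x: "x \<in> configs G A" and a: "a \<in> A" and g: "g \<in> carrier G" for x a g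
  proof -
    note unshift = shift_shift_inv[OF assms(1) g]
    obtain w where w: "w \<in> configs G A" "asymptotic G w (shift G (inv\<^bsub>G\<^esub> g) x)"
      "?\<tau> w = (?\<tau> (shift G (inv\<^bsub>G\<^esub> g) x))(\<one>\<^bsub>G\<^esub> := a)"
      using one[OF shift_configs[OF assms(1) inv_closed[OF g] x] a] by blast
    have "?\<tau> (shift G g w) = shift G g ((shift G (inv\<^bsub>G\<^esub> g) (?\<tau> x))(\<one>\<^bsub>G\<^esub> := a))"
      using w(3) g by (simp add: local_map_shift[OF assms(1,2)])
    also have "\<dots> = (shift G g (shift G (inv\<^bsub>G\<^esub> g) (?\<tau> x)))(g := a)"
    proof -
      have "inv\<^bsub>G\<^esub> g \<otimes>\<^bsub>G\<^esub> h = \<one>\<^bsub>G\<^esub> \<longleftrightarrow> h = g" if "h \<in> carrier G" for h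
        using that g by (metis inv_closed inv_equality inv_inv l_inv)
      then show ?thesis using g by (auto simp: shift_def fun_eq_iff)
    qed
    also have "\<dots> = (?\<tau> x)(g := a)"
      using unshift[OF local_map_configs[OF assms(1-3) x]] by simp
    finally have "?\<tau> (shift G g w) = (?\<tau> x)(g := a)" .
    moreover have "asymptotic G (shift G g w) x"
      using asymptotic_shift[OF assms(1) g w(2)] unshift[OF x] by simp
    ultimately show ?thesis using shift_configs[OF assms(1) g w(1)] by blast
  qed
  have "\<exists>z\<in>configs G A. asymptotic G z x \<and> ?\<tau> z = y"
    if "finite E" "E \<subseteq> carrier G" "x \<in> configs G A" "y \<in> configs G A"
      "\<forall>h\<in>carrier G - E. y h = ?\<tau> x h" for E x y
    using that
  proof (induction E arbitrary: y rule: finite_induct)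
    case empty
    then have "?\<tau> x = y"
      using configs_eqI[OF local_map_configs[OF assms(1-3)]] by (metis Diff_empty)
    then show ?case using empty asymptotic_refl by blast
  next
    case (insert g E)
    then have g: "g \<in> carrier G" by blast
    \<comment> \<open>Resetting the value at \<open>g\<close> leaves a target that differs from the
      image of \<open>x\<close> only on the smaller set, so the induction hypothesis reaches it. One
      more correction at \<open>g\<close> then restores \<open>y g\<close>.\<close>
    define y' where "y' = y(g := ?\<tau> x g)"
    have "y' \<in> configs G A"
      unfolding y'_def using insert.prems g configsD[OF local_map_configs[OF assms(1-3)]]
      by (intro configs_upd) auto
    moreover have "\<forall>h\<in>carrier G - E. y' h = ?\<tau> x h"
      using insert.prems unfolding y'_def by auto
    ultimately obtain z where z: "z \<in> configs G A" "asymptotic G z x" "?\<tau> z = y'"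
      using insert.IH insert.prems by blast
    obtain z' where z': "z' \<in> configs G A" "asymptotic G z' z" "?\<tau> z' = (?\<tau> z)(g := y g)"
      using pt[OF z(1) _ g] configsD[OF insert.prems(3) g] by blast
    have "?\<tau> z' = y" using z(3) z'(3) unfolding y'_def by simp
    with z' z asymptotic_trans show ?case by blast
  qed
  then show ?thesis unfolding post_surjective_def asymptotic_iff[of G _ "?\<tau> _"] by blast
qed

section \<open>Windows\<close>

text \<open>
  The cells \<open>halo G M E\<close> contain the identity and all cells whose image depends on the values
  in \<open>E\<close>; \<open>window G M E\<close> contains all cells that the images of these depend on.
\<close>

definition halo :: "('g, 'm) monoid_scheme \<Rightarrow> 'g set \<Rightarrow> 'g set \<Rightarrow> 'g set" where
  "halo G M E = insert \<one>\<^bsub>G\<^esub> {g \<in> carrier G. \<exists>m\<in>M. g \<otimes>\<^bsub>G\<^esub> m \<in> E}"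

definition window :: "('g, 'm) monoid_scheme \<Rightarrow> 'g set \<Rightarrow> 'g set \<Rightarrow> 'g set" where
  "window G M E = E \<union> halo G M E \<union> (\<lambda>(g, m). g \<otimes>\<^bsub>G\<^esub> m) ` (halo G M E \<times> M)"

lemma halo_subset: "group G \<Longrightarrow> halo G M E \<subseteq> carrier G"
  unfolding halo_def using group.is_monoid monoid.one_closed by fastforce

lemma window_subset:
  assumes "group G" "M \<subseteq> carrier G" "E \<subseteq> carrier G"
  shows "window G M E \<subseteq> carrier G"
proof -
  interpret group G by fact
  show ?thesis
    unfolding window_def using halo_subset[OF assms(1), of M E] assms(2,3) by auto
qed

text \<open>A cell \<open>g\<close> with \<open>g \<otimes> m = h\<close> in \<open>E\<close> is
  determined by the pair \<open>(h, m)\<close>, which bounds the halo by an image of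
  \<open>E \<times> M\<close>.\<close>

lemma finite_window:
  assumes "group G" "M \<subseteq> carrier G" "finite M" "finite E"
  shows "finite (window G M E)"
proof -
  interpret group G by fact
  have "{g \<in> carrier G. \<exists>m\<in>M. g \<otimes>\<^bsub>G\<^esub> m \<in> E} \<subseteq> (\<lambda>(h, m). h \<otimes>\<^bsub>G\<^esub> inv\<^bsub>G\<^esub> m) ` (E \<times> M)"
  proof safe
    fix g m assume "g \<in> carrier G" "m \<in> M" "g \<otimes>\<^bsub>G\<^esub> m \<in> E"
    moreover from this have "g = g \<otimes>\<^bsub>G\<^esub> m \<otimes>\<^bsub>G\<^esub> inv\<^bsub>G\<^esub> m"
      using assms(2) by (auto simp: m_assoc)
    ultimately show "g \<in> (\<lambda>(h, m). h \<otimes>\<^bsub>G\<^esub> inv\<^bsub>G\<^esub> m) ` (E \<times> M)" by force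
  qed
  then have "finite (halo G M E)"
    unfolding halo_def using assms(3,4) by (simp add: finite_subset)
  then show ?thesis unfolding window_def using assms(3,4) by auto
qed

section \<open>Uniform post-surjectivity\<close>

text \<open>With a finite alphabet the product of discrete spaces is compact by Tychonoff. The
  configurations that agree with \<open>x\<close> on the finite set \<open>W x\<close> form an open
  neighbourhood of \<open>x\<close>, and finitely many of these neighbourhoods cover the space. The
  size of \<open>W x\<close> may vary with \<open>x\<close>.\<close>

lemma finite_cylinder_cover:
  assumes "finite A"
    and W: "\<And>x. x \<in> configs G A \<Longrightarrow> finite (W x) \<and> W x \<subseteq> carrier G"
  shows "\<exists>X. finite X \<and> X \<subseteq> configs G A \<and>
    (\<forall>y\<in>configs G A. \<exists>x\<in>X. \<forall>h\<in>W x. y h = x h)"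
proof -
  let ?T = "product_topology (\<lambda>_. discrete_topology A) (carrier G)"
  \<comment> \<open>This is the cylinder around \<open>x\<close> written as a product set, all but
    finitely many of whose factors are the full alphabet.\<close>
  define U where "U x = (\<Pi>\<^sub>E h\<in>carrier G. if h \<in> W x then {x h} else A)" for x
  have top: "topspace ?T = configs G A"
    by (simp add: configs_def)
  have "compact_space ?T"
    using \<open>finite A\<close> by (simp add: compact_space_product_topology compact_space_discrete_topology)
  moreover have "openin ?T (U x)" if "x \<in> configs G A" for x
  proof -
    have "finite {h \<in> carrier G. (if h \<in> W x then {x h} else A) \<noteq> topspace (discrete_topology A)}"
      using W[OF that] by (elim conjE finite_subset[rotated]) auto
    then show ?thesis
      unfolding U_def using configsD[OF that] by (subst openin_PiE_gen) auto
  qed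
  moreover have "topspace ?T \<subseteq> \<Union> (U ` configs G A)"
  proof
    fix x assume "x \<in> topspace ?T"
    then have "x \<in> configs G A" by (simp only: top)
    moreover from this have "x \<in> U x"
      unfolding U_def configs_def by (auto simp: PiE_iff)
    ultimately show "x \<in> \<Union> (U ` configs G A)" by blast
  qed
  ultimately have "\<exists>\<F>. finite \<F> \<and> \<F> \<subseteq> U ` configs G A \<and> topspace ?T \<subseteq> \<Union>\<F>"
    unfolding compact_space_alt by (elim allE[of _ "U ` configs G A"]) blast
  then obtain \<F> where \<F>: "finite \<F>" "\<F> \<subseteq> U ` configs G A" "topspace ?T \<subseteq> \<Union>\<F>"
    by blast
  then obtain X where X: "finite X" "X \<subseteq> configs G A" "\<F> = U ` X"
    by (meson finite_subset_image)
  have "\<exists>x\<in>X. \<forall>h\<in>W x. y h = x h" if y: "y \<in> configs G A" for y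
  proof -
    obtain x where "x \<in> X" "y \<in> U x" using \<F>(3) X(3) y unfolding top by blast
    moreover from this have "y h = x h" if "h \<in> W x" for h
      using that W X(2) unfolding U_def by (auto simp: PiE_iff split: if_splits)
    ultimately show ?thesis by blast
  qed
  with X show ?thesis by blast
qed

text \<open>For one \<open>x\<close>, finitely many letters give one finite set \<open>D x\<close>
  of cells to be changed. The same set serves all configurations that agree with \<open>x\<close> on
  the window of \<open>D x\<close>, so a finite cover by such cylinders yields a common set.\<close>

lemma uniform_post_surjective:
  assumes "group G" "finite A" "finite M" "M \<subseteq> carrier G" "\<mu> \<in> (M \<rightarrow>\<^sub>E A) \<rightarrow> A"
    and "post_surjective G A (local_map G M \<mu>)"
  obtains E where "finite E" "E \<subseteq> carrier G"
    "\<And>x a. x \<in> configs G A \<Longrightarrow> a \<in> A \<Longrightarrow> \<exists>z\<in>configs G A.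
       (\<forall>h\<in>carrier G - E. z h = x h) \<and> local_map G M \<mu> z = (local_map G M \<mu> x)(\<one>\<^bsub>G\<^esub> := a)"
proof -
  interpret group G by fact
  let ?\<tau> = "local_map G M \<mu>"
  define good where "good D x \<longleftrightarrow> (\<forall>a\<in>A. \<exists>z\<in>configs G A.
    (\<forall>h\<in>carrier G - D. z h = x h) \<and> ?\<tau> z = (?\<tau> x)(\<one>\<^bsub>G\<^esub> := a))" for D x
  have good_mono: "good D' x" if D: "good D x" "D \<subseteq> D'" for D D' x
    unfolding good_def
  proof
    fix a assume "a \<in> A"
    then obtain z where "z \<in> configs G A" "\<forall>h\<in>carrier G - D. z h = x h"
      "?\<tau> z = (?\<tau> x)(\<one>\<^bsub>G\<^esub> := a)"
      using D(1) unfolding good_def by blast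
    with D(2) show "\<exists>z\<in>configs G A. (\<forall>h\<in>carrier G - D'. z h = x h) \<and>
        ?\<tau> z = (?\<tau> x)(\<one>\<^bsub>G\<^esub> := a)" by (intro bexI[of _ z]) auto
  qed
  have "\<exists>D. finite D \<and> D \<subseteq> carrier G \<and> good D x" if x: "x \<in> configs G A" for x
  proof -
    have "\<exists>D. finite D \<and> D \<subseteq> carrier G \<and> (\<exists>z\<in>configs G A.
        (\<forall>h\<in>carrier G - D. z h = x h) \<and> ?\<tau> z = (?\<tau> x)(\<one>\<^bsub>G\<^esub> := a))" if "a \<in> A" for a
    proof -
      \<comment> \<open>Changing one cell gives an asymptotic target, so post-surjectivity applies.
        The resulting set of changed cells still depends on both \<open>x\<close> and
        \<open>a\<close>.\<close>
      have "asymptotic G ((?\<tau> x)(\<one>\<^bsub>G\<^esub> := a)) (?\<tau> x)"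
        unfolding asymptotic_iff by (intro exI[of _ "{\<one>\<^bsub>G\<^esub>}"]) auto
      moreover have "(?\<tau> x)(\<one>\<^bsub>G\<^esub> := a) \<in> configs G A"
        using that local_map_configs[OF assms(1,4,5) x] by (intro configs_upd) auto
      ultimately obtain z where "z \<in> configs G A" "asymptotic G z x"
        "?\<tau> z = (?\<tau> x)(\<one>\<^bsub>G\<^esub> := a)"
        using assms(6) x unfolding post_surjective_def by blast
      then show ?thesis unfolding asymptotic_iff by blast
    qed
    then obtain D where D: "\<And>a. a \<in> A \<Longrightarrow> finite (D a) \<and> D a \<subseteq> carrier G \<and> (\<exists>z\<in>configs G A.
        (\<forall>h\<in>carrier G - D a. z h = x h) \<and> ?\<tau> z = (?\<tau> x)(\<one>\<^bsub>G\<^esub> := a))" by metis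
    have "good (\<Union> (D ` A)) x"
      unfolding good_def
    proof
      fix a assume a: "a \<in> A"
      obtain z where "z \<in> configs G A" "\<forall>h\<in>carrier G - D a. z h = x h"
        "?\<tau> z = (?\<tau> x)(\<one>\<^bsub>G\<^esub> := a)"
        using D[OF a] by blast
      with a show "\<exists>z\<in>configs G A. (\<forall>h\<in>carrier G - \<Union> (D ` A). z h = x h) \<and>
          ?\<tau> z = (?\<tau> x)(\<one>\<^bsub>G\<^esub> := a)" by (intro bexI[of _ z]) simp_all
    qed
    moreover have "finite (D a)" "D a \<subseteq> carrier G" if "a \<in> A" for a
      using D[OF that] by blast+
    then have "finite (\<Union> (D ` A))" "\<Union> (D ` A) \<subseteq> carrier G" using \<open>finite A\<close> by auto
    ultimately show ?thesis by blast
  qed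
  then obtain D where D: "\<And>x. x \<in> configs G A \<Longrightarrow>
      finite (D x) \<and> D x \<subseteq> carrier G \<and> good (D x) x" by metis
  \<comment> \<open>Agreement on \<open>D x\<close> alone would not suffice: the window also
    contains every cell read by a cell whose image the correction may affect.\<close>
  define W where "W x = window G M (D x)" for x
  have "finite (W x) \<and> W x \<subseteq> carrier G" if "x \<in> configs G A" for x
    unfolding W_def using D[OF that] finite_window[OF assms(1,4,3)] window_subset[OF assms(1,4)]
    by blast
  with assms(2) have "\<exists>X. finite X \<and> X \<subseteq> configs G A \<and>
      (\<forall>y\<in>configs G A. \<exists>x\<in>X. \<forall>h\<in>W x. y h = x h)"
    by (rule finite_cylinder_cover)
  then obtain X where X: "finite X" "X \<subseteq> configs G A"
    "\<forall>y\<in>configs G A. \<exists>x\<in>X. \<forall>h\<in>W x. y h = x h"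
    by (elim exE conjE)
  have good: "good (D x) y"
    if x: "x \<in> configs G A" and y: "y \<in> configs G A" and agree: "\<forall>h\<in>W x. y h = x h" for x y
    unfolding good_def
  proof
    fix a assume "a \<in> A"
    then obtain z where z: "z \<in> configs G A" "\<forall>h\<in>carrier G - D x. z h = x h"
      "?\<tau> z = (?\<tau> x)(\<one>\<^bsub>G\<^esub> := a)"
      using D[OF x] unfolding good_def by blast
    \<comment> \<open>The correction found for \<open>x\<close> is grafted onto \<open>y\<close>. On
      \<open>W x\<close> the result equals \<open>z\<close>, since outside \<open>D x\<close> the
      configurations \<open>z\<close>, \<open>x\<close> and \<open>y\<close> agree there.\<close>
    define z' where "z' = (\<lambda>h\<in>carrier G. if h \<in> D x then z h else y h)"
    have z': "z' \<in> configs G A"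
      unfolding z'_def using configsD[OF z(1)] configsD[OF y] by (intro configs_restrictI) auto
    have Wsub: "W x \<subseteq> carrier G"
      unfolding W_def using D[OF x] window_subset[OF assms(1,4)] by blast
    have z'W: "z' h = z h" if "h \<in> W x" for h
      using that Wsub z(2) agree unfolding z'_def by auto
    have "?\<tau> z' g = ((?\<tau> y)(\<one>\<^bsub>G\<^esub> := a)) g" if g: "g \<in> carrier G" for g
    \<comment> \<open>A cell of the halo reads only inside \<open>W x\<close>, so the images of
      \<open>z'\<close> and \<open>y\<close> there are those of \<open>z\<close> and
      \<open>x\<close>. A cell outside the halo reads nothing in \<open>D x\<close>, and it is not
      the identity, so it must keep the image of \<open>y\<close>.\<close>
    proof (cases "g \<in> halo G M (D x)")
      case True
      then have gm: "g \<otimes>\<^bsub>G\<^esub> m \<in> W x" if "m \<in> M" for m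
        using that unfolding W_def window_def by auto
      have "?\<tau> z' g = ?\<tau> z g" "?\<tau> y g = ?\<tau> x g"
        by (intro local_map_cong[OF g]; use z'W agree gm in simp)+
      then show ?thesis using z(3) by simp
    next
      case False
      then have "g \<noteq> \<one>\<^bsub>G\<^esub>" and off: "\<And>m. m \<in> M \<Longrightarrow> g \<otimes>\<^bsub>G\<^esub> m \<notin> D x"
        using g unfolding halo_def by auto
      have "?\<tau> z' g = ?\<tau> y g"
        by (intro local_map_cong[OF g]) (use g off assms(4) in \<open>auto simp: z'_def\<close>)
      then show ?thesis using \<open>g \<noteq> \<one>\<^bsub>G\<^esub>\<close> by simp
    qed
    then have "?\<tau> z' = (?\<tau> y)(\<one>\<^bsub>G\<^esub> := a)"
      using local_map_configs[OF assms(1,4,5)] z' y \<open>a \<in> A\<close>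
      by (intro configs_eqI[OF _ configs_upd]) auto
    moreover have "\<forall>h\<in>carrier G - D x. z' h = y h" unfolding z'_def by simp
    ultimately show "\<exists>z\<in>configs G A. (\<forall>h\<in>carrier G - D x. z h = y h) \<and>
        ?\<tau> z = (?\<tau> y)(\<one>\<^bsub>G\<^esub> := a)" using z' by blast
  qed
  let ?E = "\<Union> (D ` X)"
  have "good ?E y" if y: "y \<in> configs G A" for y
  proof -
    obtain x where "x \<in> X" "\<forall>h\<in>W x. y h = x h" using X(3) y by blast
    then have "good (D x) y" using good X(2) y by blast
    with \<open>x \<in> X\<close> show ?thesis by (intro good_mono[of "D x" y ?E]) auto
  qed
  moreover have "finite (D x)" "D x \<subseteq> carrier G" if "x \<in> X" for x
    using D X(2) that by blast+
  then have "finite ?E" "?E \<subseteq> carrier G" using X(1) by auto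
  ultimately show thesis using that[of ?E] unfolding good_def by simp
qed

section \<open>Transfer along an epimorphism\<close>

text \<open>The pattern is pulled back along \<phi>: elements of \<open>M\<close> with the same
  image in \<open>K\<close> read the same value.\<close>

definition push_rule :: "('g \<Rightarrow> 'k) \<Rightarrow> 'g set \<Rightarrow> (('g \<Rightarrow> 'a) \<Rightarrow> 'a) \<Rightarrow> ('k \<Rightarrow> 'a) \<Rightarrow> 'a" where
  "push_rule \<phi> M \<mu> p = \<mu> (\<lambda>m\<in>M. p (\<phi> m))"

text \<open>A copy of \<open>w\<close> on \<open>P\<close> is placed in \<open>K\<close> over the
  background \<open>x\<close>. It is faithful when \<phi> is injective on \<open>P\<close>, since
  \<open>inv_into\<close> then returns the original cell.\<close>

definition transplant ::
    "('k, 'n) monoid_scheme \<Rightarrow> ('g \<Rightarrow> 'k) \<Rightarrow> 'g set \<Rightarrow> ('g \<Rightarrow> 'a) \<Rightarrow> ('k \<Rightarrow> 'a) \<Rightarrow> ('k \<Rightarrow> 'a)" where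
  "transplant K \<phi> P w x = (\<lambda>k\<in>carrier K. if k \<in> \<phi> ` P then w (inv_into P \<phi> k) else x k)"

lemma push_rule_funcset:
  "\<mu> \<in> (M \<rightarrow>\<^sub>E A) \<rightarrow> A \<Longrightarrow> push_rule \<phi> M \<mu> \<in> (\<phi> ` M \<rightarrow>\<^sub>E A) \<rightarrow> A"
  unfolding push_rule_def by (intro funcsetI, erule funcset_mem) auto

text \<open>Since \<phi> is multiplicative, the cell \<phi>\<open>(g)\<close> reads the images of
  exactly the cells read by \<open>g\<close>, so agreement on these cells is enough.\<close>

lemma local_map_push:
  assumes "\<phi> \<in> hom G K" "M \<subseteq> carrier G" "g \<in> carrier G"
    and "\<And>m. m \<in> M \<Longrightarrow> x (\<phi> (g \<otimes>\<^bsub>G\<^esub> m)) = w (g \<otimes>\<^bsub>G\<^esub> m)"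
  shows "local_map K (\<phi> ` M) (push_rule \<phi> M \<mu>) x (\<phi> g) = local_map G M \<mu> w g"
proof -
  have "(\<lambda>m\<in>M. restrict (\<lambda>k. x (\<phi> g \<otimes>\<^bsub>K\<^esub> k)) (\<phi> ` M) (\<phi> m)) = (\<lambda>m\<in>M. w (g \<otimes>\<^bsub>G\<^esub> m))"
  proof (rule restrict_ext)
    fix m assume "m \<in> M"
    then show "restrict (\<lambda>k. x (\<phi> g \<otimes>\<^bsub>K\<^esub> k)) (\<phi> ` M) (\<phi> m) = w (g \<otimes>\<^bsub>G\<^esub> m)"
      using assms(2) assms(4)[of m] hom_mult[OF assms(1,3), of m] by auto
  qed
  moreover have "\<phi> g \<in> carrier K" using assms(1,3) by (rule hom_in_carrier)
  ultimately show ?thesis using assms(3) by (simp add: local_map_def push_rule_def)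
qed

lemma transplant_apply:
  assumes "\<phi> \<in> hom G K" "P \<subseteq> carrier G" "inj_on \<phi> P" "h \<in> P"
  shows "transplant K \<phi> P w x (\<phi> h) = w h"
  using assms hom_in_carrier[OF assms(1)] unfolding transplant_def by auto

lemma transplant_configs:
  assumes "P \<subseteq> carrier G" "w \<in> configs G A" "\<And>k. k \<in> carrier K \<Longrightarrow> x k \<in> A"
  shows "transplant K \<phi> P w x \<in> configs K A"
  unfolding transplant_def
  using assms(1,3) inv_into_into[of _ \<phi> P] by (intro configs_restrictI) (auto intro!: configsD[OF assms(2)])

text \<open>If \<open>k\<close> times \<phi>\<open>(m)\<close> equals \<phi>\<open>(h)\<close> with
  \<open>h\<close> in \<open>E\<close>, then \<open>k\<close> is the image of
  \<open>h \<otimes> inv m\<close>, which lies in the halo. Hence a cell outside the image of the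
  halo reads nothing in the image of \<open>E\<close>.\<close>

lemma local_map_push_off_halo:
  assumes "group G" "group K" "\<phi> \<in> hom G K" "M \<subseteq> carrier G" "E \<subseteq> carrier G"
    and k: "k \<in> carrier K" "k \<notin> \<phi> ` halo G M E"
    and eq: "\<And>k. k \<in> carrier K \<Longrightarrow> k \<notin> \<phi> ` E \<Longrightarrow> x k = y k"
  shows "local_map K (\<phi> ` M) \<nu> x k = local_map K (\<phi> ` M) \<nu> y k"
proof (rule local_map_cong[OF k(1)])
  interpret group_hom G K \<phi>
    using assms(1-3) by (simp add: group_hom_def group_hom_axioms_def)
  fix n assume "n \<in> \<phi> ` M"
  then obtain m where m: "m \<in> M" "m \<in> carrier G" "n = \<phi> m" using assms(4) by blast
  have "k \<otimes>\<^bsub>K\<^esub> n \<notin> \<phi> ` E"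
  proof
    assume "k \<otimes>\<^bsub>K\<^esub> n \<in> \<phi> ` E"
    then obtain h where h: "h \<in> E" "h \<in> carrier G" "k \<otimes>\<^bsub>K\<^esub> \<phi> m = \<phi> h"
      using assms(5) m(3) by blast
    have "k = k \<otimes>\<^bsub>K\<^esub> \<phi> m \<otimes>\<^bsub>K\<^esub> inv\<^bsub>K\<^esub> (\<phi> m)"
      using m k(1) by (simp add: H.m_assoc)
    also have "\<dots> = \<phi> (h \<otimes>\<^bsub>G\<^esub> inv\<^bsub>G\<^esub> m)" using h m by simp
    finally have "k = \<phi> (h \<otimes>\<^bsub>G\<^esub> inv\<^bsub>G\<^esub> m)" .
    moreover have "h \<otimes>\<^bsub>G\<^esub> inv\<^bsub>G\<^esub> m \<in> halo G M E"
      unfolding halo_def using h m by (auto simp: G.m_assoc intro!: bexI[of _ m])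
    ultimately show False using k(2) by blast
  qed
  then show "x (k \<otimes>\<^bsub>K\<^esub> n) = y (k \<otimes>\<^bsub>K\<^esub> n)" using k(1) m by (intro eq) auto
qed

section \<open>Post-surjectivity passes to the quotient\<close>

text \<open>A configuration on \<open>K\<close> is pulled back to \<open>G\<close>, corrected there
  inside \<open>E\<close>, and the correction is copied to \<open>K\<close> through the window. The
  set \<open>E\<close> must be uniform because \<phi> is fixed before the configuration is
  given.\<close>

lemma post_surjective_push:
  assumes "group G" "group K" "\<phi> \<in> epi G K" "M \<subseteq> carrier G" "\<mu> \<in> (M \<rightarrow>\<^sub>E A) \<rightarrow> A"
    and E: "finite E" "E \<subseteq> carrier G"
    and unif: "\<And>x a. x \<in> configs G A \<Longrightarrow> a \<in> A \<Longrightarrow> \<exists>z\<in>configs G A.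
       (\<forall>h\<in>carrier G - E. z h = x h) \<and> local_map G M \<mu> z = (local_map G M \<mu> x)(\<one>\<^bsub>G\<^esub> := a)"
    and inj: "inj_on \<phi> (window G M E)"
  shows "post_surjective K A (local_map K (\<phi> ` M) (push_rule \<phi> M \<mu>))"
proof -
  have hom: "\<phi> \<in> hom G K" using assms(3) by (simp add: epi_def)
  interpret group_hom G K \<phi>
    using assms(1,2) hom by (simp add: group_hom_def group_hom_axioms_def)
  let ?W = "window G M E" and ?\<tau> = "local_map G M \<mu>"
    and ?\<sigma> = "local_map K (\<phi> ` M) (push_rule \<phi> M \<mu>)"
  have W: "?W \<subseteq> carrier G" by (rule window_subset[OF assms(1,4) E(2)])
  have \<phi>M: "\<phi> ` M \<subseteq> carrier K" using assms(4) by auto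
  have \<sigma>: "?\<sigma> x \<in> configs K A" if "x \<in> configs K A" for x
    using local_map_configs[OF assms(2) \<phi>M push_rule_funcset[OF assms(5)] that] .
  have "\<exists>z\<in>configs K A. asymptotic K z x \<and> ?\<sigma> z = (?\<sigma> x)(\<one>\<^bsub>K\<^esub> := a)"
    if x: "x \<in> configs K A" and a: "a \<in> A" for x a
  proof -
    define w where "w = (\<lambda>g\<in>carrier G. x (\<phi> g))"
    have w: "w \<in> configs G A"
      unfolding w_def using configsD[OF x] by (intro configs_restrictI) auto
    obtain z where z: "z \<in> configs G A" "\<And>h. h \<in> carrier G - E \<Longrightarrow> z h = w h"
      "?\<tau> z = (?\<tau> w)(\<one>\<^bsub>G\<^esub> := a)"
      using unif[OF w a] by blast
    define z' where "z' = transplant K \<phi> ?W z x"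
    have z'c: "z' \<in> configs K A"
      unfolding z'_def using transplant_configs[OF W z(1)] configsD[OF x] by blast
    have z'W: "z' (\<phi> h) = z h" if "h \<in> ?W" for h
      \<comment> \<open>Injectivity on the window makes the copy exact.\<close>
      unfolding z'_def using transplant_apply[OF hom W inj that] .
    have z'x: "z' k = x k" if k: "k \<in> carrier K" "k \<notin> \<phi> ` E" for k
    proof (cases "k \<in> \<phi> ` ?W")
      case True
      then obtain h where h: "h \<in> ?W" "k = \<phi> h" by blast
      then have "h \<in> carrier G - E" using W k(2) by blast
      then show ?thesis using z'W[OF h(1)] z(2)[of h] h(2) by (simp add: w_def)
    next
      case False
      then show ?thesis using k(1) by (simp add: z'_def transplant_def)
    qed
    \<comment> \<open>Over the image of the halo both images can be computed in \<open>G\<close>,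
      from \<open>z\<close> and \<open>w\<close>. Elsewhere nothing that is read has
      changed.\<close>
    have "?\<sigma> z' k = ((?\<sigma> x)(\<one>\<^bsub>K\<^esub> := a)) k" if k: "k \<in> carrier K" for k
    proof (cases "k \<in> \<phi> ` halo G M E")
      case True
      then obtain g where g: "g \<in> halo G M E" "k = \<phi> g" by blast
      have gc: "g \<in> carrier G" using g(1) halo_subset[OF assms(1)] by blast
      have gm: "g \<otimes>\<^bsub>G\<^esub> m \<in> ?W" if "m \<in> M" for m
        using that g(1) unfolding window_def by auto
      have "?\<sigma> z' k = ?\<tau> z g"
        unfolding g(2) using gm z'W by (intro local_map_push[OF hom assms(4) gc]) auto
      moreover have "?\<sigma> x k = ?\<tau> w g"
        unfolding g(2) using gm W by (intro local_map_push[OF hom assms(4) gc]) (auto simp: w_def)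
      \<comment> \<open>The identity lies in the window, so injectivity prevents any other halo cell
        from landing on the identity of \<open>K\<close>. The update thus hits the same cell on both
        sides.\<close>
      moreover have "k = \<one>\<^bsub>K\<^esub> \<longleftrightarrow> g = \<one>\<^bsub>G\<^esub>"
      proof -
        have "g \<in> ?W" "\<one>\<^bsub>G\<^esub> \<in> ?W" using g(1) by (auto simp: window_def halo_def)
        then have "\<phi> g = \<phi> \<one>\<^bsub>G\<^esub> \<longleftrightarrow> g = \<one>\<^bsub>G\<^esub>" using inj by (meson inj_on_eq_iff)
        then show ?thesis using g(2) by simp
      qed
      ultimately show ?thesis using z(3) by simp
    next
      case False
      have "\<one>\<^bsub>G\<^esub> \<in> halo G M E" by (simp add: halo_def)
      then have "k \<noteq> \<one>\<^bsub>K\<^esub>" using False hom_one by (metis image_eqI)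
      then show ?thesis
        using local_map_push_off_halo[OF assms(1,2) hom assms(4) E(2) k False z'x] by simp
    qed
    then have "?\<sigma> z' = (?\<sigma> x)(\<one>\<^bsub>K\<^esub> := a)"
      using configs_eqI[OF \<sigma>[OF z'c] configs_upd[OF \<sigma>[OF x] _ a]] by simp
    moreover have "asymptotic K z' x"
      unfolding asymptotic_iff using E z'x by (intro exI[of _ "\<phi> ` E"]) auto
    ultimately show ?thesis using z'c by blast
  qed
  then show ?thesis
    by (intro post_surjective_local_mapI[OF assms(2) \<phi>M push_rule_funcset[OF assms(5)]])
qed

section \<open>Pre-injectivity is pulled back for a given pair of configurations\<close>

text \<open>Copying the window of the difference set \<open>D\<close> to \<open>K\<close> preserves
  both the difference of the two configurations and the equality of their images.\<close>

lemma pre_injective_pull: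
  assumes "group G" "group K" "\<phi> \<in> hom G K" "M \<subseteq> carrier G"
    and pre: "pre_injective K A (local_map K (\<phi> ` M) (push_rule \<phi> M \<mu>))"
    and x: "x \<in> configs G A" and y: "y \<in> configs G A"
    and D: "finite D" "D \<subseteq> carrier G" "\<And>h. h \<in> carrier G - D \<Longrightarrow> x h = y h"
    and inj: "inj_on \<phi> (window G M D)"
    and eq: "local_map G M \<mu> x = local_map G M \<mu> y"
  shows "x = y"
proof -
  interpret group_hom G K \<phi>
    using assms(1-3) by (simp add: group_hom_def group_hom_axioms_def)
  let ?W = "window G M D" and ?\<sigma> = "local_map K (\<phi> ` M) (push_rule \<phi> M \<mu>)"
  have W: "?W \<subseteq> carrier G" by (rule window_subset[OF assms(1,4) D(2)])
  \<comment> \<open>Any common background would do. The value of \<open>x\<close> at the identity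
    supplies a letter of \<open>A\<close>, and sharing the background makes the two copies differ at
    most on the image of \<open>D\<close>.\<close>
  define c where "c = (\<lambda>_ :: 'c. x \<one>\<^bsub>G\<^esub>)"
  define x' where "x' = transplant K \<phi> ?W x c"
  define y' where "y' = transplant K \<phi> ?W y c"
  have c: "c k \<in> A" for k
    unfolding c_def by (rule configsD[OF x G.one_closed])
  have conf: "x' \<in> configs K A" "y' \<in> configs K A"
    unfolding x'_def y'_def by (rule transplant_configs[OF W x c] transplant_configs[OF W y c])+
  have W': "x' (\<phi> h) = x h" "y' (\<phi> h) = y h" if "h \<in> ?W" for h
    unfolding x'_def y'_def using transplant_apply[OF assms(3) W inj that] by blast+
  have off: "x' k = y' k" if k: "k \<in> carrier K" "k \<notin> \<phi> ` D" for k
  proof (cases "k \<in> \<phi> ` ?W")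
    case True
    then obtain h where h: "h \<in> ?W" "k = \<phi> h" by blast
    then have "h \<in> carrier G - D" using W k(2) by blast
    then show ?thesis using W'[OF h(1)] D(3) h(2) by simp
  next
    case False
    then show ?thesis using k(1) by (simp add: x'_def y'_def transplant_def)
  qed
  have "?\<sigma> x' k = ?\<sigma> y' k" if k: "k \<in> carrier K" for k
  proof (cases "k \<in> \<phi> ` halo G M D")
    case True
    then obtain g where g: "g \<in> halo G M D" "k = \<phi> g" by blast
    have gc: "g \<in> carrier G" using g(1) halo_subset[OF assms(1)] by blast
    have gm: "g \<otimes>\<^bsub>G\<^esub> m \<in> ?W" if "m \<in> M" for m
      using that g(1) unfolding window_def by auto
    have "?\<sigma> x' k = local_map G M \<mu> x g" "?\<sigma> y' k = local_map G M \<mu> y g"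
      unfolding g(2) using gm W' by (intro local_map_push[OF assms(3,4) gc]; simp)+
    then show ?thesis using eq by simp
  next
    case False
    then show ?thesis
      using local_map_push_off_halo[OF assms(1-4) D(2) k False off] by simp
  qed
  then have "?\<sigma> x' = ?\<sigma> y'" unfolding local_map_def by (auto simp: fun_eq_iff)
  moreover have "asymptotic K x' y'"
    unfolding asymptotic_iff using D off by (intro exI[of _ "\<phi> ` D"]) auto
  ultimately have "x' = y'" using pre conf unfolding pre_injective_def by blast
  \<comment> \<open>Equality of the copies gives equality on the window, which contains
    \<open>D\<close>; outside \<open>D\<close> the configurations agree from the start.\<close>
  have "x h = y h" if "h \<in> carrier G" for h
  proof (cases "h \<in> D")
    case True
    then have "h \<in> ?W" by (simp add: window_def)
    then show ?thesis using W' \<open>x' = y'\<close> by metis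
  qed (use that D(3) in blast)
  then show ?thesis using configs_eqI[OF x y] by blast
qed

section \<open>Choice of one epimorphism for both transfers\<close>

theorem theorem5p5:
  fixes G :: "('g, 'm) monoid_scheme"
  assumes "group G"
    and "\<And>E. finite E \<Longrightarrow> E \<subseteq> carrier G \<Longrightarrow>
           \<exists>(K :: 'k monoid) \<phi>. group K \<and> post_injunctive K \<and>
             \<phi> \<in> epi G K \<and> inj_on \<phi> E"
  shows "post_injunctive G"
  unfolding post_injunctive_def
proof (intro allI impI)
  fix A :: "nat set" and \<tau>
  assume A: "finite A" and ca: "cellular_automaton G A \<tau>" and ps: "post_surjective G A \<tau>"
  obtain M \<mu> where M: "finite M" "M \<subseteq> carrier G" and \<mu>: "\<mu> \<in> (M \<rightarrow>\<^sub>E A) \<rightarrow> A"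
    and \<tau>: "\<And>x. x \<in> configs G A \<Longrightarrow> \<tau> x = local_map G M \<mu> x"
    using ca unfolding cellular_automaton_iff[OF assms(1)] by blast
  have "post_surjective G A (local_map G M \<mu>)"
    using ps \<tau> unfolding post_surjective_def by (metis (no_types, lifting))
  then obtain E where E: "finite E" "E \<subseteq> carrier G"
    and unif: "\<And>x a. x \<in> configs G A \<Longrightarrow> a \<in> A \<Longrightarrow> \<exists>z\<in>configs G A.
       (\<forall>h\<in>carrier G - E. z h = x h) \<and> local_map G M \<mu> z = (local_map G M \<mu> x)(\<one>\<^bsub>G\<^esub> := a)"
    using uniform_post_surjective[OF assms(1) A M \<mu>] by metis
  show "pre_injective G A \<tau>"
    unfolding pre_injective_def
  proof (intro ballI impI)
    fix x y assume xy: "x \<in> configs G A" "y \<in> configs G A" and "asymptotic G x y" and "\<tau> x = \<tau> y"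
    then obtain D where D: "finite D" "D \<subseteq> carrier G" "\<And>h. h \<in> carrier G - D \<Longrightarrow> x h = y h"
      unfolding asymptotic_iff by blast
    \<comment> \<open>The set \<open>E\<close> depends only on the automaton, \<open>D\<close> on
      the pair \<open>x\<close>, \<open>y\<close>. The group \<open>K\<close> may depend on the
      pair, so \<phi> is taken injective on the union of both windows.\<close>
    have "finite (window G M E \<union> window G M D)" "window G M E \<union> window G M D \<subseteq> carrier G"
      using finite_window[OF assms(1) M(2,1)] window_subset[OF assms(1) M(2)] E D by auto
    then obtain K :: "'k monoid" and \<phi> where K: "group K" "post_injunctive K"
      and \<phi>: "\<phi> \<in> epi G K" and "inj_on \<phi> (window G M E \<union> window G M D)"
      using assms(2) by blast
    then have inj: "inj_on \<phi> (window G M E)" "inj_on \<phi> (window G M D)"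
      by (simp_all add: inj_on_Un)
    have hom: "\<phi> \<in> hom G K" using \<phi> by (simp add: epi_def)
    have "cellular_automaton K A (local_map K (\<phi> ` M) (push_rule \<phi> M \<mu>))"
      unfolding cellular_automaton_iff[OF K(1)]
      using M hom_in_carrier[OF hom] push_rule_funcset[OF \<mu>]
      by (intro exI[of _ "\<phi> ` M"] exI[of _ "push_rule \<phi> M \<mu>"]) auto
    moreover have "post_surjective K A (local_map K (\<phi> ` M) (push_rule \<phi> M \<mu>))"
      using post_surjective_push[OF assms(1) K(1) \<phi> M(2) \<mu> E unif inj(1)] .
    ultimately have "pre_injective K A (local_map K (\<phi> ` M) (push_rule \<phi> M \<mu>))"
      using K(2) A unfolding post_injunctive_def by blast
    moreover have "local_map G M \<mu> x = local_map G M \<mu> y"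
      using \<open>\<tau> x = \<tau> y\<close> \<tau> xy by simp
    ultimately show "x = y"
      using pre_injective_pull[OF assms(1) K(1) hom M(2)] xy D inj(2) by blast
  qed
qed

end
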